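(* Let $(X,\cdot,d)$ be a complete metric invariant group with identity element $e$. Then $S(X)$ is a dense subset of $(Lip^1(X),\rho)$, and for all $f,g\in S(X)$, $$\arg\min(f\oplus g)=\arg\min(f)\cdot\arg\min(g).$$ In other words, the map $\arg\min:(S(X),\oplus,\rho)\to(X,\cdot,d)$ is a continuous monoid morphism and is onto. Moreover, $\arg\min\circ\gamma=I$, where $I$ is the identity map on $X$ and $\gamma:(X,\cdot)\to(S(X),\oplus)$ is the Kuratowski operator.
   Context: A group $(X,\cdot)$ with a metric $d$ is metric invariant if $d(xy,xz)=d(yx,zx)=d(y,z)$ for all $x,y,z\in X$; it is complete if $(X,d)$ is a complete metric space. $Lip^1(X)$ is the set of all $1$-Lipschitz functions $f:X\to\mathbb{R}$ that are bounded from below; it is a monoid for the inf-convolution $(f\oplus g)(x):=\inf\{f(y)+g(z): y,z\in X,\ yz=x\}$, with identity element $d(e,\cdot)$. For $f,g\in Lip^1(X)$, $$\rho(f,g)=\sup_{x\in X}\frac{|f(x)-g(x)|}{1+|f(x)-g(x)|}.$$ A function $f:X\to\mathbb{R}$ has a strong minimum at $x_0$ if $\inf_X f=f(x_0)$ and for every $\epsilon>0$ there is $\delta>0$ such that $0\le f(x)-f(x_0)\le\delta$ implies $d(x,x_0)\le\epsilon$. $S(X)$ is the set of $f\in Lip^1(X)$ having a strong minimum (at some point); it is a submonoid of $(Lip^1(X),\oplus)$. $\arg\min(f)=\{x\in X: f(x)=\inf_{y\in X}f(y)\}$; for $f\in S(X)$ this is a singleton $\{x_f\}$, identified with the element $x_f\in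 X$. The Kuratowski operator is $\gamma(x)=d(x,\cdot)$. *)

theory Defs
  imports "HOL-Analysis.Analysis" "HOL-Algebra.Coset"
begin

definition metric_invariant :: "('a, 'b) monoid_scheme \<Rightarrow> ('a \<Rightarrow> 'a \<Rightarrow> real) \<Rightarrow> bool" where
  "metric_invariant G d \<longleftrightarrow>
     (\<forall>x\<in>carrier G. \<forall>y\<in>carrier G. \<forall>z\<in>carrier G.
        d (x \<otimes>\<^bsub>G\<^esub> y) (x \<otimes>\<^bsub>G\<^esub> z) = d y z \<and> d (y \<otimes>\<^bsub>G\<^esub> x) (z \<otimes>\<^bsub>G\<^esub> x) = d y z)"

text \<open>Real-valued functions on a set \<open>X\<close> are represented by members of \<open>extensional X\<close>, so that
  equality in \<open>Lip1 X d\<close> is equality of functions on \<open>X\<close>.\<close>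

definition Lip1 :: "'a set \<Rightarrow> ('a \<Rightarrow> 'a \<Rightarrow> real) \<Rightarrow> ('a \<Rightarrow> real) set" where
  "Lip1 X d = {f \<in> extensional X.
     (\<forall>x\<in>X. \<forall>y\<in>X. \<bar>f x - f y\<bar> \<le> d x y) \<and> bdd_below (f ` X)}"

definition rho :: "'a set \<Rightarrow> ('a \<Rightarrow> real) \<Rightarrow> ('a \<Rightarrow> real) \<Rightarrow> real" where
  "rho X f g = (SUP x\<in>X. \<bar>f x - g x\<bar> / (1 + \<bar>f x - g x\<bar>))"

definition inf_conv :: "('a, 'b) monoid_scheme \<Rightarrow> ('a \<Rightarrow> real) \<Rightarrow> ('a \<Rightarrow> real) \<Rightarrow> 'a \<Rightarrow> real" where
  "inf_conv G f g = (\<lambda>x\<in>carrier G.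
     Inf {f y + g z | y z. y \<in> carrier G \<and> z \<in> carrier G \<and> y \<otimes>\<^bsub>G\<^esub> z = x})"

text \<open>The infimum over \<open>X\<close> below is a genuine one only for functions that are bounded from below;
  \<open>strong_min_at\<close> and \<open>argmin_set\<close> are used for such functions only.\<close>

definition strong_min_at :: "'a set \<Rightarrow> ('a \<Rightarrow> 'a \<Rightarrow> real) \<Rightarrow> ('a \<Rightarrow> real) \<Rightarrow> 'a \<Rightarrow> bool" where
  "strong_min_at X d f x0 \<longleftrightarrow> x0 \<in> X \<and> (INF x\<in>X. f x) = f x0 \<and>
     (\<forall>\<epsilon>>0. \<exists>\<delta>>0. \<forall>x\<in>X. 0 \<le> f x - f x0 \<and> f x - f x0 \<le> \<delta> \<longrightarrow> d x x0 \<le> \<epsilon>)"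

definition Smin :: "'a set \<Rightarrow> ('a \<Rightarrow> 'a \<Rightarrow> real) \<Rightarrow> ('a \<Rightarrow> real) set" where
  "Smin X d = {f \<in> Lip1 X d. \<exists>x0. strong_min_at X d f x0}"

definition argmin_set :: "'a set \<Rightarrow> ('a \<Rightarrow> real) \<Rightarrow> 'a set" where
  "argmin_set X f = {x \<in> X. f x = (INF y\<in>X. f y)}"

text \<open>The point \<open>x\<^sub>f\<close> with which the singleton \<open>argmin_set X f\<close> is identified.\<close>

definition argmin_pt :: "'a set \<Rightarrow> ('a \<Rightarrow> real) \<Rightarrow> 'a" where
  "argmin_pt X f = the_elem (argmin_set X f)"

definition kuratowski :: "'a set \<Rightarrow> ('a \<Rightarrow> 'a \<Rightarrow> real) \<Rightarrow> 'a \<Rightarrow> 'a \<Rightarrow> real" where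
  "kuratowski X d x = (\<lambda>y\<in>X. d x y)"

definition Lip1_monoid :: "('a, 'b) monoid_scheme \<Rightarrow> ('a \<Rightarrow> 'a \<Rightarrow> real) \<Rightarrow> ('a \<Rightarrow> real) monoid" where
  "Lip1_monoid G d =
     \<lparr>carrier = Lip1 (carrier G) d, mult = inf_conv G, one = kuratowski (carrier G) d \<one>\<^bsub>G\<^esub>\<rparr>"

definition Smin_monoid :: "('a, 'b) monoid_scheme \<Rightarrow> ('a \<Rightarrow> 'a \<Rightarrow> real) \<Rightarrow> ('a \<Rightarrow> real) monoid" where
  "Smin_monoid G d = (Lip1_monoid G d)\<lparr>carrier := Smin (carrier G) d\<rparr>"

end

theory Submission
  imports Defs
begin

text \<open>Density: given \<open>f\<close> and \<open>\<epsilon> > 0\<close>, put \<open>m = inf f\<close> and pick \<open>a\<close> with \<open>f a < m + \<epsilon>\<close>. Then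
  \<open>x \<mapsto> min (max (f x) (m + \<epsilon>)) (m + d a x)\<close> is 1-Lipschitz, within \<open>\<epsilon>\<close> of \<open>f\<close>, and has a strong
  minimum at \<open>a\<close>, because it is at least \<open>m + min \<epsilon> (d a x)\<close>. For the morphism property, almost
  minimal values of \<open>f \<oplus> g\<close> come from almost minimal values of \<open>f\<close> and \<open>g\<close>, and
  \<open>d (y z) (a b) \<le> d y a + d z b\<close> by invariance.\<close>

section \<open>The metric on the Lipschitz functions\<close>

text \<open>Since \<open>s / (1 + s)\<close> is \<open>1 - 1 / (1 + s)\<close>, it increases with
  \<open>s\<close>. This carries pointwise bounds into \<open>rho\<close> and back out.\<close>

lemma divide_one_plus_mono:
  fixes s t :: real
  assumes "0 \<le> s" "s \<le> t"
  shows "s / (1 + s) \<le> t / (1 + t)"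
  using assms by (simp add: field_simps)

lemma bdd_above_rho_terms:
  fixes f g :: "'a \<Rightarrow> real"
  shows "bdd_above ((\<lambda>x. \<bar>f x - g x\<bar> / (1 + \<bar>f x - g x\<bar>)) ` X)"
  by (rule bdd_aboveI2[where M = 1]) simp

lemma rho_upper:
  assumes "x \<in> X"
  shows "\<bar>f x - g x\<bar> / (1 + \<bar>f x - g x\<bar>) \<le> rho X f g"
  unfolding rho_def by (rule cSUP_upper[OF assms bdd_above_rho_terms])

text \<open>Uniform closeness gives closeness for \<open>rho\<close>, because
  \<open>t / (1 + t) \<le> t\<close>.\<close>

lemma rho_le:
  assumes "X \<noteq> {}" "0 \<le> t" "\<And>x. x \<in> X \<Longrightarrow> \<bar>f x - g x\<bar> \<le> t"
  shows "rho X f g \<le> t"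
  unfolding rho_def
proof (rule cSUP_least[OF assms(1)])
  fix x assume "x \<in> X"
  then have "\<bar>f x - g x\<bar> / (1 + \<bar>f x - g x\<bar>) \<le> t / (1 + t)"
    by (intro divide_one_plus_mono assms) auto
  also have "\<dots> \<le> t"
    using assms(2) by (simp add: field_simps)
  finally show "\<bar>f x - g x\<bar> / (1 + \<bar>f x - g x\<bar>) \<le> t" .
qed

text \<open>The converse direction: closeness for \<open>rho\<close> gives uniform closeness. One
  point with a gap of at least \<open>t\<close> would already push the supremum up to
  \<open>t / (1 + t)\<close>.\<close>

lemma rho_less_imp:
  assumes "x \<in> X" "0 < t" "rho X f g < t / (1 + t)"
  shows "\<bar>f x - g x\<bar> < t"
proof (rule ccontr)
  assume "\<not> \<bar>f x - g x\<bar> < t"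
  then have "t / (1 + t) \<le> \<bar>f x - g x\<bar> / (1 + \<bar>f x - g x\<bar>)"
    using assms(2) by (intro divide_one_plus_mono) auto
  with rho_upper[OF assms(1), of f g] assms(3) show False
    by simp
qed

lemma rho_nonneg: "X \<noteq> {} \<Longrightarrow> 0 \<le> rho X f g"
  using rho_upper[of _ X f g] by (meson all_not_in_conv abs_ge_zero add_nonneg_nonneg
      divide_nonneg_nonneg order_trans zero_le_one)

text \<open>Stated for any family \<open>S\<close> so that it serves both \<open>Lip1\<close> and
  \<open>Smin\<close>. Extensionality turns agreement on \<open>X\<close> into equality of
  functions.\<close>

lemma Metric_space_rho:
  assumes "X \<noteq> {}" "S \<subseteq> extensional X"
  shows "Metric_space S (rho X)"
proof
  fix f g h :: "'a \<Rightarrow> real"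
  show "0 \<le> rho X f g"
    using assms(1) by (rule rho_nonneg)
  show "rho X f g = rho X g f"
    by (simp add: rho_def abs_minus_commute)
  show "rho X f g = 0 \<longleftrightarrow> f = g" if "f \<in> S" "g \<in> S"
  proof
    assume 0: "rho X f g = 0"
    have "f x = g x" if "x \<in> X" for x
    proof (rule ccontr)
      assume "f x \<noteq> g x"
      then have "0 < \<bar>f x - g x\<bar> / (1 + \<bar>f x - g x\<bar>)"
        by (intro divide_pos_pos) auto
      with rho_upper[OF that, of f g] 0 show False
        by simp
    qed
    then show "f = g"
      using that assms(2) by (intro extensionalityI[of f X g]) auto
  qed (simp add: rho_def assms(1))
  show "rho X f h \<le> rho X f g + rho X g h"
    unfolding rho_def[of X f h]
  proof (rule cSUP_least[OF assms(1)])
    fix x assume x: "x \<in> X"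
    define s t where "s = \<bar>f x - g x\<bar>" and "t = \<bar>g x - h x\<bar>"
    have st: "0 \<le> s" "0 \<le> t"
      by (auto simp: s_def t_def)
    have "\<bar>f x - h x\<bar> / (1 + \<bar>f x - h x\<bar>) \<le> (s + t) / (1 + (s + t))"
      by (rule divide_one_plus_mono) (auto simp: s_def t_def)
    also have "\<dots> = s / (1 + (s + t)) + t / (1 + (s + t))"
      by (simp add: add_divide_distrib)
    \<comment> \<open>Subadditivity of \<open>t / (1 + t)\<close>: dropping a nonnegative summand
      from each denominator enlarges the fraction.\<close>
    also have "\<dots> \<le> s / (1 + s) + t / (1 + t)"
      using st by (intro add_mono divide_left_mono) auto
    also have "\<dots> \<le> rho X f g + rho X g h"
      using rho_upper[OF x, of f g] rho_upper[OF x, of g h] by (simp add: s_def t_def)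
    finally show "\<bar>f x - h x\<bar> / (1 + \<bar>f x - h x\<bar>) \<le> rho X f g + rho X g h" .
  qed
qed

section \<open>Strong minima\<close>

lemma Lip1D:
  assumes "f \<in> Lip1 X d"
  shows "f \<in> extensional X" "bdd_below (f ` X)"
    and "\<And>x y. x \<in> X \<Longrightarrow> y \<in> X \<Longrightarrow> f x \<le> f y + d x y"
  using assms by (auto simp: Lip1_def abs_le_iff algebra_simps)

text \<open>A one-sided Lipschitz bound suffices, since exchanging \<open>x\<close> and
  \<open>y\<close> yields the other side.\<close>

lemma (in Metric_space) Lip1I:
  assumes "f \<in> extensional M"
    and "\<And>x. x \<in> M \<Longrightarrow> c \<le> f x"
    and "\<And>x y. x \<in> M \<Longrightarrow> y \<in> M \<Longrightarrow> f x \<le> f y + d x y"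
  shows "f \<in> Lip1 M d"
proof -
  have "\<bar>f x - f y\<bar> \<le> d x y" if "x \<in> M" "y \<in> M" for x y
    using assms(3)[OF that] assms(3)[OF that(2,1)] by (simp add: commute abs_le_iff)
  then show ?thesis
    using assms(1) bdd_belowI2[of M c f, OF assms(2)] by (simp add: Lip1_def)
qed

lemma strong_min_atI:
  assumes "a \<in> X" "\<And>x. x \<in> X \<Longrightarrow> f a \<le> f x"
    and "\<And>\<epsilon>. \<epsilon> > 0 \<Longrightarrow> \<exists>\<delta>>0. \<forall>x\<in>X. f x \<le> f a + \<delta> \<longrightarrow> d x a \<le> \<epsilon>"
  shows "strong_min_at X d f a"
proof -
  have "(INF x\<in>X. f x) = f a"
    using assms(1,2) by (intro cInf_eq_minimum) auto
  moreover have "\<exists>\<delta>>0. \<forall>x\<in>X. 0 \<le> f x - f a \<and> f x - f a \<le> \<delta> \<longrightarrow> d x a \<le> \<epsilon>" if "\<epsilon> > 0" for \<epsilon>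
    using assms(3)[OF that] by (simp add: diff_le_eq add.commute) blast
  ultimately show ?thesis
    using assms(1) by (simp add: strong_min_at_def)
qed

text \<open>Boundedness from below makes the \<open>INF\<close> a true lower bound; minimality then
  absorbs the guard \<open>0 \<le> f x - f a\<close>. With \<open>strong_min_atI\<close>, later
  proofs can use plain inequalities.\<close>

lemma strong_min_atD:
  assumes "strong_min_at X d f a" "bdd_below (f ` X)"
  shows "a \<in> X" "\<And>x. x \<in> X \<Longrightarrow> f a \<le> f x"
    and "\<And>\<epsilon>. \<epsilon> > 0 \<Longrightarrow> \<exists>\<delta>>0. \<forall>x\<in>X. f x \<le> f a + \<delta> \<longrightarrow> d x a \<le> \<epsilon>"
proof -
  show "a \<in> X"
    using assms(1) by (simp add: strong_min_at_def)
  show min: "f a \<le> f x" if "x \<in> X" for x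
    using cINF_lower[OF assms(2) that] assms(1) by (simp add: strong_min_at_def)
  show "\<exists>\<delta>>0. \<forall>x\<in>X. f x \<le> f a + \<delta> \<longrightarrow> d x a \<le> \<epsilon>" if "\<epsilon> > 0" for \<epsilon>
  proof -
    have "\<exists>\<delta>>0. \<forall>x\<in>X. 0 \<le> f x - f a \<and> f x - f a \<le> \<delta> \<longrightarrow> d x a \<le> \<epsilon>"
      using assms(1) that by (simp add: strong_min_at_def)
    then obtain \<delta> where "\<delta> > 0" "\<And>x. x \<in> X \<Longrightarrow> 0 \<le> f x - f a \<Longrightarrow> f x - f a \<le> \<delta> \<Longrightarrow> d x a \<le> \<epsilon>"
      by blast
    then show ?thesis
      using min by (intro exI[of _ \<delta>]) (auto simp: algebra_simps)
  qed
qed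

section \<open>Unique minimisers and the Kuratowski functions\<close>

context Metric_space
begin

text \<open>A second minimiser meets the smallness condition for every \<delta>, so its distance to
  \<open>a\<close> is below every positive \<epsilon>.\<close>

lemma argmin_set_strong_min:
  assumes "f \<in> Lip1 M d" "strong_min_at M d f a"
  shows "argmin_set M f = {a}"
proof -
  note min = strong_min_atD[OF assms(2) Lip1D(2)[OF assms(1)]]
  have inf: "(INF x\<in>M. f x) = f a"
    using assms(2) by (simp add: strong_min_at_def)
  have "x = a" if "x \<in> M" "f x = f a" for x
  proof -
    have "d x a \<le> 0 + \<epsilon>" if "\<epsilon> > 0" for \<epsilon>
      using min(3)[OF that] \<open>x \<in> M\<close> \<open>f x = f a\<close> by force
    then have "d x a \<le> 0"
      by (rule field_le_epsilon)
    then have "d x a = 0"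
      using nonneg[of x a] by linarith
    then show ?thesis
      using \<open>x \<in> M\<close> min(1) by simp
  qed
  then show ?thesis
    using min(1) inf by (auto simp: argmin_set_def)
qed

lemma argmin_pt_strong_min:
  assumes "f \<in> Lip1 M d" "strong_min_at M d f a"
  shows "argmin_pt M f = a"
  using argmin_set_strong_min[OF assms] by (simp add: argmin_pt_def)

lemma strong_min_at_argmin_pt:
  assumes "f \<in> Smin M d"
  shows "strong_min_at M d f (argmin_pt M f)"
  using assms argmin_pt_strong_min by (auto simp: Smin_def)

lemma argmin_set_Smin:
  assumes "f \<in> Smin M d"
  shows "argmin_set M f = {argmin_pt M f}"
  using assms argmin_set_strong_min[OF _ strong_min_at_argmin_pt] by (simp add: Smin_def)

lemma argmin_pt_in: "f \<in> Smin M d \<Longrightarrow> argmin_pt M f \<in> M"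
  using strong_min_at_argmin_pt by (simp add: strong_min_at_def)

lemma Lip1_kuratowski:
  assumes "a \<in> M"
  shows "kuratowski M d a \<in> Lip1 M d"
proof (rule Lip1I[where c = 0])
  fix x y assume "x \<in> M" "y \<in> M"
  then show "kuratowski M d a x \<le> kuratowski M d a y + d x y"
    using triangle[OF assms, of y x] by (simp add: kuratowski_def commute)
qed (simp_all add: kuratowski_def)

text \<open>The value at \<open>a\<close> is 0, so the condition on values is the condition on
  distances and \<delta> = \<epsilon> serves.\<close>

lemma strong_min_at_kuratowski:
  assumes "a \<in> M"
  shows "strong_min_at M d (kuratowski M d a) a"
  using assms by (intro strong_min_atI) (auto simp: kuratowski_def commute)

lemma Smin_kuratowski: "a \<in> M \<Longrightarrow> kuratowski M d a \<in> Smin M d"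
  using Lip1_kuratowski strong_min_at_kuratowski by (auto simp: Smin_def)

lemma argmin_pt_kuratowski: "a \<in> M \<Longrightarrow> argmin_pt M (kuratowski M d a) = a"
  by (rule argmin_pt_strong_min[OF Lip1_kuratowski strong_min_at_kuratowski])

section \<open>Uniform approximation by functions with a strong minimum\<close>

lemma Smin_approx:
  assumes f: "f \<in> Lip1 M d" and "M \<noteq> {}" "0 < \<epsilon>"
  obtains g where "g \<in> Smin M d" "\<And>x. x \<in> M \<Longrightarrow> \<bar>f x - g x\<bar> \<le> \<epsilon>"
proof -
  define m where "m = (INF x\<in>M. f x)"
  have m: "m \<le> f x" if "x \<in> M" for x
    unfolding m_def by (rule cINF_lower[OF Lip1D(2)[OF f] that])
  have "(INF x\<in>M. f x) < m + \<epsilon>"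
    using \<open>0 < \<epsilon>\<close> by (simp add: m_def)
  then obtain a where a: "a \<in> M" "f a < m + \<epsilon>"
    using cINF_less_iff[OF \<open>M \<noteq> {}\<close> Lip1D(2)[OF f]] by blast
  define g where "g = (\<lambda>x\<in>M. min (max (f x) (m + \<epsilon>)) (m + d a x))"
  have g: "g x = min (max (f x) (m + \<epsilon>)) (m + d a x)" if "x \<in> M" for x
    using that by (simp add: g_def)
  have ga: "g a = m"
    using a \<open>0 < \<epsilon>\<close> by (simp add: g)
  \<comment> \<open>The flattened branch of \<open>g\<close> is at least
    \<open>m + \<epsilon>\<close>, and the cone branch equals \<open>m + d a x\<close>.\<close>
  have gm: "m + min \<epsilon> (d a x) \<le> g x" if "x \<in> M" for x
    using that by (simp add: g min_def max_def)
  have "g \<in> Lip1 M d"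
  proof (rule Lip1I[where c = m])
    fix x y assume xy: "x \<in> M" "y \<in> M"
    \<comment> \<open>With the cone covered, all ingredients of \<open>g\<close> (\<open>f\<close>,
      a constant, the cone) are 1-Lipschitz, and \<open>min\<close> and \<open>max\<close> preserve
      this.\<close>
    have "d a x \<le> d a y + d x y"
      using triangle[OF a(1) xy(2,1)] by (simp add: commute)
    with Lip1D(3)[OF f xy] nonneg[of x y] show "g x \<le> g y + d x y"
      unfolding g[OF xy(1)] g[OF xy(2)] by linarith
  next
    fix x assume "x \<in> M"
    then show "m \<le> g x"
      using gm[of x] \<open>0 < \<epsilon>\<close> nonneg[of a x] by linarith
  qed (simp add: g_def)
  moreover have "strong_min_at M d g a"
  proof (rule strong_min_atI)
    show "a \<in> M" by fact
    show "g a \<le> g x" if "x \<in> M" for x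
      using gm[OF that] ga \<open>0 < \<epsilon>\<close> nonneg[of a x] by linarith
    show "\<exists>\<delta>>0. \<forall>x\<in>M. g x \<le> g a + \<delta> \<longrightarrow> d x a \<le> \<eta>" if "\<eta> > 0" for \<eta>
    \<comment> \<open>Staying below \<epsilon> rules out the case where the minimum in
      \<open>gm\<close> is \<epsilon>, which leaves \<open>d a x \<le> \<eta>\<close>.\<close>
    proof (intro exI[of _ "min (\<epsilon> / 2) \<eta>"] conjI ballI impI)
      show "0 < min (\<epsilon> / 2) \<eta>"
        using that \<open>0 < \<epsilon>\<close> by simp
      fix x assume "x \<in> M" "g x \<le> g a + min (\<epsilon> / 2) \<eta>"
      then show "d x a \<le> \<eta>"
        using gm[of x] ga \<open>0 < \<epsilon>\<close> by (subst commute) linarith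
    qed
  qed
  moreover have "\<bar>f x - g x\<bar> \<le> \<epsilon>" if "x \<in> M" for x
  proof -
    \<comment> \<open>As \<open>f a < m + \<epsilon>\<close>, the cone lies at most \<epsilon> below
      \<open>f\<close>. In the other direction, \<open>g\<close> is at most
      \<open>max (f x) (m + \<epsilon>)\<close>, hence at most \<open>f x + \<epsilon>\<close>
      because \<open>m \<le> f x\<close>.\<close>
    have "f x \<le> f a + d a x"
      using Lip1D(3)[OF f that a(1)] by (simp add: commute)
    then show ?thesis
      using a(2) m[OF that] \<open>0 < \<epsilon>\<close> nonneg[of a x] unfolding g[OF that] by linarith
  qed
  ultimately show thesis
    using that by (auto simp: Smin_def)
qed

section \<open>Density and continuity with respect to \<open>rho\<close>\<close>

lemma Metric_space_Lip1: "M \<noteq> {} \<Longrightarrow> Metric_space (Lip1 M d) (rho M)"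
  by (rule Metric_space_rho) (auto simp: Lip1_def)

lemma Metric_space_Smin: "M \<noteq> {} \<Longrightarrow> Metric_space (Smin M d) (rho M)"
  by (rule Metric_space_rho) (auto simp: Smin_def Lip1_def)

text \<open>The closure is described by closed balls, so the non-strict bound of
  \<open>Smin_approx\<close>, passed through \<open>rho_le\<close>, is enough.\<close>

lemma closure_of_Smin:
  assumes "M \<noteq> {}"
  shows "Metric_space.mtopology (Lip1 M d) (rho M) closure_of Smin M d = Lip1 M d"
proof -
  interpret L: Metric_space "Lip1 M d" "rho M"
    using assms by (rule Metric_space_Lip1)
  have "\<exists>g\<in>Smin M d. g \<in> L.mcball f r" if f: "f \<in> Lip1 M d" and r: "r > 0" for f r
  proof -
    obtain g where g: "g \<in> Smin M d" "\<And>x. x \<in> M \<Longrightarrow> \<bar>f x - g x\<bar> \<le> r"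
      using Smin_approx[OF f assms r] by blast
    then have "rho M f g \<le> r"
      using assms r by (intro rho_le) auto
    then show ?thesis
      using g(1) f by (auto simp: Smin_def)
  qed
  then show ?thesis
    unfolding L.metric_closure_of_alt by blast
qed

text \<open>If \<open>g\<close> is uniformly within \<open>\<delta> / 2\<close> of \<open>f\<close>,
  with minimisers \<open>b\<close> and \<open>a\<close>, then \<open>f b \<le> g b + \<delta> / 2
  \<le> g a + \<delta> / 2 \<le> f a + \<delta>\<close>. The strong minimum of \<open>f\<close> then
  forces \<open>b\<close> close to \<open>a\<close>.\<close>

lemma continuous_map_argmin_pt:
  assumes "M \<noteq> {}"
  shows "continuous_map (Metric_space.mtopology (Smin M d) (rho M)) mtopology (argmin_pt M)"
proof -
  interpret S: Metric_space "Smin M d" "rho M"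
    using assms by (rule Metric_space_Smin)
  have "\<exists>\<delta>>0. \<forall>g. g \<in> Smin M d \<and> rho M f g < \<delta> \<longrightarrow> d (argmin_pt M f) (argmin_pt M g) < \<epsilon>"
    if f: "f \<in> Smin M d" and "\<epsilon> > 0" for f \<epsilon>
  proof -
    let ?a = "argmin_pt M f"
    have a: "?a \<in> M"
      using f by (rule argmin_pt_in)
    have bdd: "bdd_below (h ` M)" if "h \<in> Smin M d" for h
      using that Lip1D(2)[of h] by (auto simp: Smin_def)
    obtain \<delta> where \<delta>: "\<delta> > 0" "\<And>x. x \<in> M \<Longrightarrow> f x \<le> f ?a + \<delta> \<Longrightarrow> d x ?a \<le> \<epsilon> / 2"
      using strong_min_atD(3)[OF strong_min_at_argmin_pt[OF f] bdd[OF f], of "\<epsilon> / 2"] \<open>\<epsilon> > 0\<close>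
      by auto
    \<comment> \<open>The threshold at which \<open>rho_less_imp\<close> yields a uniform gap below
      \<open>\<delta> / 2\<close>.\<close>
    define \<eta> where "\<eta> = \<delta> / 2 / (1 + \<delta> / 2)"
    have "\<eta> > 0"
      using \<delta>(1) by (simp add: \<eta>_def)
    moreover have "d ?a (argmin_pt M g) < \<epsilon>" if g: "g \<in> Smin M d" "rho M f g < \<eta>" for g
    proof -
      let ?b = "argmin_pt M g"
      have b: "?b \<in> M"
        using g(1) by (rule argmin_pt_in)
      have close: "\<bar>f x - g x\<bar> < \<delta> / 2" if "x \<in> M" for x
        using rho_less_imp[OF that, of "\<delta> / 2" f g] \<delta>(1) g(2) by (simp add: \<eta>_def)
      have "g ?b \<le> g ?a"
        using strong_min_atD(2)[OF strong_min_at_argmin_pt[OF g(1)] bdd[OF g(1)]] a .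
      then have "f ?b \<le> f ?a + \<delta>"
        using close[OF a] close[OF b] by linarith
      then have "d ?b ?a \<le> \<epsilon> / 2"
        using \<delta>(2) b by blast
      then show ?thesis
        using \<open>\<epsilon> > 0\<close> by (simp add: commute)
    qed
    ultimately show ?thesis
      by blast
  qed
  then show ?thesis
    using argmin_pt_in unfolding S.metric_continuous_map[OF Metric_space_axioms] by blast
qed

end

section \<open>Inf-convolution\<close>

text \<open>Describes the infimum by its lower bounds, so later proofs need not handle
  \<open>Inf\<close>. It is a true infimum: the factorisation of \<open>x\<close> as unit times
  \<open>x\<close> makes the set nonempty, and lower bounds of \<open>f\<close> and \<open>g\<close>
  add up to one of the set.\<close>

lemma le_inf_conv_iff:
  assumes "group G" "f \<in> Lip1 (carrier G) d" "g \<in> Lip1 (carrier G) d" "x \<in> carrier G"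
  shows "c \<le> inf_conv G f g x \<longleftrightarrow>
    (\<forall>y\<in>carrier G. \<forall>z\<in>carrier G. y \<otimes>\<^bsub>G\<^esub> z = x \<longrightarrow> c \<le> f y + g z)"
proof -
  interpret group G by fact
  let ?S = "{f y + g z | y z. y \<in> carrier G \<and> z \<in> carrier G \<and> y \<otimes>\<^bsub>G\<^esub> z = x}"
  obtain a b where "\<And>y. y \<in> carrier G \<Longrightarrow> a \<le> f y" "\<And>z. z \<in> carrier G \<Longrightarrow> b \<le> g z"
    using Lip1D(2)[OF assms(2)] Lip1D(2)[OF assms(3)] by (auto simp: bdd_below_def)
  then have "bdd_below ?S"
    by (intro bdd_belowI[where m = "a + b"]) (auto intro: add_mono)
  moreover have "f \<one>\<^bsub>G\<^esub> + g x \<in> ?S"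
    using assms(4) by force
  then have "?S \<noteq> {}"
    by blast
  ultimately have "c \<le> Inf ?S \<longleftrightarrow> (\<forall>t\<in>?S. c \<le> t)"
    by (intro le_cInf_iff)
  then show ?thesis
    using assms(4) by (auto simp: inf_conv_def)
qed

section \<open>The inf-convolution monoid over an invariant metric group\<close>

locale metric_invariant_group = group G + Metric_space "carrier G" d
  for G :: "('a, 'b) monoid_scheme" (structure) and d +
  assumes invariant: "metric_invariant G d"
begin

lemma carrier_nonempty: "carrier G \<noteq> {}"
  using one_closed by blast

lemma left_invariant:
  "x \<in> carrier G \<Longrightarrow> y \<in> carrier G \<Longrightarrow> z \<in> carrier G \<Longrightarrow> d (x \<otimes> y) (x \<otimes> z) = d y z"
  using invariant by (simp add: metric_invariant_def)

lemma right_invariant: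
  "x \<in> carrier G \<Longrightarrow> y \<in> carrier G \<Longrightarrow> z \<in> carrier G \<Longrightarrow> d (y \<otimes> x) (z \<otimes> x) = d y z"
  using invariant by (simp add: metric_invariant_def)

text \<open>Pass through \<open>a \<otimes> z\<close>: right invariance measures the first leg and
  left invariance the second.\<close>

lemma dist_mult_le:
  assumes "y \<in> carrier G" "z \<in> carrier G" "a \<in> carrier G" "b \<in> carrier G"
  shows "d (y \<otimes> z) (a \<otimes> b) \<le> d y a + d z b"
  using triangle[of "y \<otimes> z" "a \<otimes> z" "a \<otimes> b"] assms by (simp add: left_invariant right_invariant)

lemmas le_inf_conv = le_inf_conv_iff[OF group_axioms, where d = d]

lemma inf_conv_le:
  assumes "f \<in> Lip1 (carrier G) d" "g \<in> Lip1 (carrier G) d" "y \<in> carrier G" "z \<in> carrier G"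
  shows "inf_conv G f g (y \<otimes> z) \<le> f y + g z"
  using le_inf_conv[OF assms(1,2), of "y \<otimes> z" "inf_conv G f g (y \<otimes> z)"] assms(3,4) by simp

text \<open>The negation of \<open>le_inf_conv\<close>; it supplies almost optimal factorisations
  without an attained infimum.\<close>

lemma inf_conv_less:
  assumes "f \<in> Lip1 (carrier G) d" "g \<in> Lip1 (carrier G) d" "x \<in> carrier G"
    and "inf_conv G f g x < c"
  obtains y z where "y \<in> carrier G" "z \<in> carrier G" "y \<otimes> z = x" "f y + g z < c"
  using le_inf_conv[OF assms(1-3), of c] assms(4) by (auto simp: not_le)

lemma inf_conv_extensional: "inf_conv G f g \<in> extensional (carrier G)"
  by (simp add: inf_conv_def)

text \<open>A factorisation \<open>y \<otimes> z = x'\<close> becomes one of \<open>x\<close> by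
  keeping \<open>y\<close> and replacing \<open>z\<close> with \<open>inv y \<otimes> x\<close>.
  Left invariance shows that this moves the second factor by exactly \<open>d x x'\<close>, and
  \<open>g\<close> is 1-Lipschitz.\<close>

lemma Lip1_inf_conv:
  assumes f: "f \<in> Lip1 (carrier G) d" and g: "g \<in> Lip1 (carrier G) d"
  shows "inf_conv G f g \<in> Lip1 (carrier G) d"
proof -
  obtain a b where ab: "\<And>y. y \<in> carrier G \<Longrightarrow> a \<le> f y" "\<And>z. z \<in> carrier G \<Longrightarrow> b \<le> g z"
    using Lip1D(2)[OF f] Lip1D(2)[OF g] by (auto simp: bdd_below_def)
  show ?thesis
  proof (rule Lip1I[where c = "a + b"])
    show "a + b \<le> inf_conv G f g x" if "x \<in> carrier G" for x
      using ab le_inf_conv[OF f g that] by (auto intro: add_mono)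
    fix x x' assume x: "x \<in> carrier G" "x' \<in> carrier G"
    have "inf_conv G f g x - d x x' \<le> f y + g z"
      if yz: "y \<in> carrier G" "z \<in> carrier G" "y \<otimes> z = x'" for y z
    proof -
      let ?w = "inv y \<otimes> x"
      have w: "?w \<in> carrier G" "y \<otimes> ?w = x"
        using yz x by (auto simp: m_assoc[symmetric])
      have "inf_conv G f g x \<le> f y + g ?w"
        using inf_conv_le[OF f g yz(1) w(1)] w(2) by simp
      moreover have "d ?w z = d x x'"
        using left_invariant[OF yz(1) w(1) yz(2)] w(2) yz(3) by simp
      ultimately show ?thesis
        using Lip1D(3)[OF g w(1) yz(2)] by linarith
    qed
    then have "inf_conv G f g x - d x x' \<le> inf_conv G f g x'"
      using le_inf_conv[OF f g x(2)] by blast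
    then show "inf_conv G f g x \<le> inf_conv G f g x' + d x x'"
      by simp
  qed (rule inf_conv_extensional)
qed

text \<open>Both sides have the same lower bounds \<open>c\<close>, namely those of the sums over
  all factorisations of \<open>x\<close> into three factors.\<close>

lemma inf_conv_assoc:
  assumes f: "f \<in> Lip1 (carrier G) d" and g: "g \<in> Lip1 (carrier G) d"
    and h: "h \<in> Lip1 (carrier G) d"
  shows "inf_conv G (inf_conv G f g) h = inf_conv G f (inf_conv G g h)"
proof (rule extensionalityI[OF inf_conv_extensional inf_conv_extensional])
  fix x assume x: "x \<in> carrier G"
  \<comment> \<open>Moving \<open>t\<close> across the inequality lets the inner convolution be
    unfolded beside a further summand.\<close>
  have shift: "c \<le> inf_conv G f g p + t \<longleftrightarrow>
      (\<forall>y\<in>carrier G. \<forall>z\<in>carrier G. y \<otimes> z = p \<longrightarrow> c \<le> f y + g z + t)"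
    if "f \<in> Lip1 (carrier G) d" "g \<in> Lip1 (carrier G) d" "p \<in> carrier G" for f g p c t
    using le_inf_conv[OF that, of "c - t"] by (simp add: diff_le_eq)
  have "c \<le> inf_conv G (inf_conv G f g) h x \<longleftrightarrow> c \<le> inf_conv G f (inf_conv G g h) x" for c
  proof -
    have "c \<le> inf_conv G (inf_conv G f g) h x \<longleftrightarrow>
      (\<forall>p\<in>carrier G. \<forall>w\<in>carrier G. p \<otimes> w = x \<longrightarrow> c \<le> inf_conv G f g p + h w)"
      by (rule le_inf_conv[OF Lip1_inf_conv[OF f g] h x])
    also have "\<dots> \<longleftrightarrow> (\<forall>y\<in>carrier G. \<forall>z\<in>carrier G. \<forall>w\<in>carrier G.
        y \<otimes> z \<otimes> w = x \<longrightarrow> c \<le> f y + g z + h w)"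
      by (metis (no_types, opaque_lifting) m_closed shift[OF f g])
    also have "\<dots> \<longleftrightarrow> (\<forall>y\<in>carrier G. \<forall>z\<in>carrier G. \<forall>w\<in>carrier G.
        y \<otimes> (z \<otimes> w) = x \<longrightarrow> c \<le> g z + h w + f y)"
      by (simp add: m_assoc add_ac)
    also have "\<dots> \<longleftrightarrow>
      (\<forall>y\<in>carrier G. \<forall>q\<in>carrier G. y \<otimes> q = x \<longrightarrow> c \<le> inf_conv G g h q + f y)"
      by (metis (no_types, opaque_lifting) m_closed shift[OF g h])
    also have "\<dots> \<longleftrightarrow> c \<le> inf_conv G f (inf_conv G g h) x"
      using le_inf_conv[OF f Lip1_inf_conv[OF g h] x] by (simp add: add.commute)
    finally show ?thesis .
  qed
  then show "inf_conv G (inf_conv G f g) h x = inf_conv G f (inf_conv G g h) x"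
    \<comment> \<open>Taking \<open>c\<close> to be each of the two values gives both
      inequalities.\<close>
    by (meson order_refl order_antisym)
qed

text \<open>The factorisation \<open>\<one> \<otimes> x\<close> gives one inequality. The other is
  the Lipschitz bound of \<open>f\<close>, since \<open>d (y \<otimes> z) z = d y \<one>\<close> by
  right invariance.\<close>

lemma inf_conv_one_left:
  assumes f: "f \<in> Lip1 (carrier G) d"
  shows "inf_conv G (kuratowski (carrier G) d \<one>) f = f"
proof (rule extensionalityI[OF inf_conv_extensional Lip1D(1)[OF f]])
  fix x assume x: "x \<in> carrier G"
  note k = Lip1_kuratowski[OF one_closed]
  have "inf_conv G (kuratowski (carrier G) d \<one>) f x \<le> f x"
    using inf_conv_le[OF k f one_closed x] x by (simp add: kuratowski_def)
  moreover have "f (y \<otimes> z) \<le> d \<one> y + f z" if "y \<in> carrier G" "z \<in> carrier G" for y z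
    using Lip1D(3)[OF f, of "y \<otimes> z" z] right_invariant[of z y \<one>] that
    by (simp add: commute)
  then have "f x \<le> inf_conv G (kuratowski (carrier G) d \<one>) f x"
    using le_inf_conv[OF k f x] by (auto simp: kuratowski_def)
  ultimately show "inf_conv G (kuratowski (carrier G) d \<one>) f x = f x"
    by simp
qed

lemma inf_conv_one_right:
  assumes f: "f \<in> Lip1 (carrier G) d"
  shows "inf_conv G f (kuratowski (carrier G) d \<one>) = f"
proof (rule extensionalityI[OF inf_conv_extensional Lip1D(1)[OF f]])
  fix x assume x: "x \<in> carrier G"
  note k = Lip1_kuratowski[OF one_closed]
  have "inf_conv G f (kuratowski (carrier G) d \<one>) x \<le> f x"
    using inf_conv_le[OF f k x one_closed] x by (simp add: kuratowski_def)
  moreover have "f (y \<otimes> z) \<le> f y + d \<one> z" if "y \<in> carrier G" "z \<in> carrier G" for y z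
    using Lip1D(3)[OF f, of "y \<otimes> z" y] left_invariant[of y z \<one>] that
    by (simp add: commute)
  then have "f x \<le> inf_conv G f (kuratowski (carrier G) d \<one>) x"
    using le_inf_conv[OF f k x] by (auto simp: kuratowski_def)
  ultimately show "inf_conv G f (kuratowski (carrier G) d \<one>) x = f x"
    by simp
qed

lemma monoid_Lip1: "monoid (Lip1_monoid G d)"
  by (rule monoidI)
    (auto simp: Lip1_monoid_def Lip1_inf_conv inf_conv_assoc inf_conv_one_left inf_conv_one_right
      Lip1_kuratowski)

section \<open>Strong minima under inf-convolution\<close>

lemma strong_min_at_inf_conv:
  assumes f: "f \<in> Lip1 (carrier G) d" and g: "g \<in> Lip1 (carrier G) d"
    and "strong_min_at (carrier G) d f a" "strong_min_at (carrier G) d g b"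
  shows "strong_min_at (carrier G) d (inf_conv G f g) (a \<otimes> b)"
proof -
  note a = strong_min_atD[OF assms(3) Lip1D(2)[OF f]]
  note b = strong_min_atD[OF assms(4) Lip1D(2)[OF g]]
  have ab: "inf_conv G f g (a \<otimes> b) \<le> f a + g b"
    by (rule inf_conv_le[OF f g a(1) b(1)])
  \<comment> \<open>Together with \<open>ab\<close>, this makes \<open>f a + g b\<close> the minimum
    value, attained at \<open>a \<otimes> b\<close>.\<close>
  have lower: "f a + g b \<le> inf_conv G f g x" if "x \<in> carrier G" for x
    using le_inf_conv[OF f g that] a(2) b(2) by (auto intro: add_mono)
  show ?thesis
  proof (rule strong_min_atI)
    show "a \<otimes> b \<in> carrier G"
      using a(1) b(1) by simp
    show "inf_conv G f g (a \<otimes> b) \<le> inf_conv G f g x" if "x \<in> carrier G" for x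
      using ab lower[OF that] by linarith
    fix \<epsilon> :: real assume "\<epsilon> > 0"
    obtain \<delta> where \<delta>: "\<delta> > 0" "\<And>y. y \<in> carrier G \<Longrightarrow> f y \<le> f a + \<delta> \<Longrightarrow> d y a \<le> \<epsilon> / 2"
      using a(3)[of "\<epsilon> / 2"] \<open>\<epsilon> > 0\<close> by auto
    obtain \<eta> where \<eta>: "\<eta> > 0" "\<And>z. z \<in> carrier G \<Longrightarrow> g z \<le> g b + \<eta> \<Longrightarrow> d z b \<le> \<epsilon> / 2"
      using b(3)[of "\<epsilon> / 2"] \<open>\<epsilon> > 0\<close> by auto
    define \<mu> where "\<mu> = min \<delta> \<eta>"
    have \<mu>: "\<mu> > 0" "\<mu> \<le> \<delta>" "\<mu> \<le> \<eta>"
      using \<delta>(1) \<eta>(1) by (auto simp: \<mu>_def)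
    \<comment> \<open>The tolerance \<open>\<mu> / 2\<close> instead of \<mu> leaves room for the
      strict inequality that \<open>inf_conv_less\<close> requires.\<close>
    have "d x (a \<otimes> b) \<le> \<epsilon>"
      if x: "x \<in> carrier G" "inf_conv G f g x \<le> inf_conv G f g (a \<otimes> b) + \<mu> / 2" for x
    proof -
      have "inf_conv G f g x < f a + g b + \<mu>"
        using x(2) ab \<mu>(1) by linarith
      then obtain y z where yz: "y \<in> carrier G" "z \<in> carrier G" "y \<otimes> z = x"
        "f y + g z < f a + g b + \<mu>"
        using inf_conv_less[OF f g x(1)] by blast
      \<comment> \<open>The excesses \<open>f y - f a\<close> and \<open>g z - g b\<close> are
        nonnegative with sum below \<mu>, so each is below \<mu>.\<close>
      have "f y \<le> f a + \<delta>" "g z \<le> g b + \<eta>"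
        using yz(4) a(2)[OF yz(1)] b(2)[OF yz(2)] \<mu> by linarith+
      then have "d y a \<le> \<epsilon> / 2" "d z b \<le> \<epsilon> / 2"
        using \<delta>(2) \<eta>(2) yz(1,2) by blast+
      then show ?thesis
        using dist_mult_le[OF yz(1,2) a(1) b(1)] yz(3) by simp
    qed
    then show "\<exists>\<delta>>0. \<forall>x\<in>carrier G. inf_conv G f g x \<le> inf_conv G f g (a \<otimes> b) + \<delta> \<longrightarrow>
        d x (a \<otimes> b) \<le> \<epsilon>"
      using \<mu>(1) by (intro exI[of _ "\<mu> / 2"]) auto
  qed
qed

lemma Smin_inf_conv:
  assumes "f \<in> Smin (carrier G) d" "g \<in> Smin (carrier G) d"
  shows "inf_conv G f g \<in> Smin (carrier G) d"
  using assms Lip1_inf_conv strong_min_at_inf_conv unfolding Smin_def by blast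

lemma argmin_pt_inf_conv:
  assumes "f \<in> Smin (carrier G) d" "g \<in> Smin (carrier G) d"
  shows "argmin_pt (carrier G) (inf_conv G f g) =
    argmin_pt (carrier G) f \<otimes> argmin_pt (carrier G) g"
  using assms
  by (intro argmin_pt_strong_min Lip1_inf_conv strong_min_at_inf_conv strong_min_at_argmin_pt)
    (auto simp: Smin_def)

lemma argmin_set_inf_conv:
  assumes "f \<in> Smin (carrier G) d" "g \<in> Smin (carrier G) d"
  shows "argmin_set (carrier G) (inf_conv G f g) =
    argmin_set (carrier G) f <#> argmin_set (carrier G) g"
  using assms by (simp add: argmin_set_Smin Smin_inf_conv argmin_pt_inf_conv set_mult_def)

section \<open>The minimiser map as a monoid morphism onto the group\<close>

lemma submonoid_Smin: "submonoid (Smin (carrier G) d) (Lip1_monoid G d)"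
  by (rule submonoid.intro)
    (auto simp: Lip1_monoid_def Smin_inf_conv Smin_kuratowski, simp add: Smin_def)

lemma argmin_pt_hom: "argmin_pt (carrier G) \<in> hom (Smin_monoid G d) G"
  by (rule homI) (auto simp: Smin_monoid_def Lip1_monoid_def argmin_pt_in argmin_pt_inf_conv)

lemma argmin_pt_one: "argmin_pt (carrier G) \<one>\<^bsub>Smin_monoid G d\<^esub> = \<one>"
  by (simp add: Smin_monoid_def Lip1_monoid_def argmin_pt_kuratowski)

text \<open>Each point is the minimiser of its own Kuratowski function.\<close>

lemma argmin_pt_image: "argmin_pt (carrier G) ` Smin (carrier G) d = carrier G"
proof
  show "carrier G \<subseteq> argmin_pt (carrier G) ` Smin (carrier G) d"
    using argmin_pt_kuratowski Smin_kuratowski by (metis image_eqI subsetI)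
qed (auto simp: argmin_pt_in)

end

theorem corollary1:
  fixes G :: "('a, 'b) monoid_scheme" and d :: "'a \<Rightarrow> 'a \<Rightarrow> real"
  assumes "group G"
    and "Metric_space (carrier G) d"
    and "Metric_space.mcomplete (carrier G) d"
    and "metric_invariant G d"
  shows
    "Metric_space (Lip1 (carrier G) d) (rho (carrier G)) \<and>
     monoid (Lip1_monoid G d) \<and>
     submonoid (Smin (carrier G) d) (Lip1_monoid G d) \<and>
     (\<forall>f\<in>Smin (carrier G) d. argmin_set (carrier G) f = {argmin_pt (carrier G) f}) \<and>
     Metric_space.mtopology (Lip1 (carrier G) d) (rho (carrier G)) closure_of Smin (carrier G) d
       = Lip1 (carrier G) d \<and>
     (\<forall>f\<in>Smin (carrier G) d. \<forall>g\<in>Smin (carrier G) d.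
       argmin_set (carrier G) (inf_conv G f g)
         = argmin_set (carrier G) f <#>\<^bsub>G\<^esub> argmin_set (carrier G) g) \<and>
     argmin_pt (carrier G) \<in> hom (Smin_monoid G d) G \<and>
     argmin_pt (carrier G) \<one>\<^bsub>Smin_monoid G d\<^esub> = \<one>\<^bsub>G\<^esub> \<and>
     continuous_map (Metric_space.mtopology (Smin (carrier G) d) (rho (carrier G)))
       (Metric_space.mtopology (carrier G) d) (argmin_pt (carrier G)) \<and>
     argmin_pt (carrier G) ` Smin (carrier G) d = carrier G \<and>
     kuratowski (carrier G) d \<in> carrier G \<rightarrow> Smin (carrier G) d \<and>
     (\<forall>x\<in>carrier G. (argmin_pt (carrier G) \<circ> kuratowski (carrier G) d) x = x)"
proof -
  interpret metric_invariant_group G d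
    using assms by (simp add: metric_invariant_group_def metric_invariant_group_axioms_def)
  show ?thesis
    using carrier_nonempty
    by (intro conjI ballI)
      (simp_all add: Metric_space_Lip1 monoid_Lip1 submonoid_Smin argmin_set_Smin closure_of_Smin
        argmin_set_inf_conv argmin_pt_hom argmin_pt_one continuous_map_argmin_pt argmin_pt_image
        Smin_kuratowski argmin_pt_kuratowski)
qed

end
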